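(* Let $a>b>0$ be real numbers, and set $$\mathbf{K}_{+}^{(a,b)}=\mathbf{K}\left(\frac{\sqrt{a}+\sqrt{b}}{\sqrt{2(a+b)}}\right),\qquad \mathbf{K}_{-}^{(a,b)}=\mathbf{K}\left(\frac{\sqrt{a}-\sqrt{b}}{\sqrt{2(a+b)}}\right).$$ Then the following six formulae hold: $$\pi=\frac{4}{\sqrt{ab(a+b)}}\,\frac{\mathbf{K}_{-}^{(a,b)}}{\mathrm{F}_{D}^{(4)}\left(\tfrac32;\tfrac12;2\,\middle|\,1+ia,1-ia,1+ib,1-ib\right)},$$ $$\pi=\frac{4}{\sqrt{a+b}}\,\frac{\mathbf{K}_{-}^{(a,b)}}{\mathrm{F}_{D}^{(4)}\left(\tfrac12;\tfrac12;2\,\middle|\,1+ia,1-ia,1+ib,1-ib\right)},$$ $$\pi=\frac{2\sqrt{a-b}}{\sqrt{b}}\,\frac{\mathbf{K}_{+}^{(a,b)}-\mathbf{K}_{-}^{(a,b)}}{\mathrm{F}_{D}^{(3)}\left(\tfrac12;\tfrac12;2\,\middle|\,\tfrac12,\tfrac{b}{a+b},\tfrac{b}{b-a}\right)},$$ $$\pi=\frac{\sqrt{a-b}}{\sqrt{a}}\,\frac{\mathbf{K}_{+}^{(a,b)}+\mathbf{K}_{-}^{(a,b)}}{\mathrm{F}_{D}^{(3)}\left(\tfrac12;\tfrac12;1\,\middle|\,\tfrac12,\tfrac{b}{a+b},\tfrac{b}{b-a}\right)},$$ $$\pi=\frac{\sqrt{a}}{\sqrt{2(a+b)}}\,\frac{\mathbf{K}_{+}^{(a,b)}+\mathbf{K}_{-}^{(a,b)}}{\mathrm{F}_{D}^{(3)}\left(\tfrac12;\tfrac12;1\,\middle|\,-1,\tfrac{b}{a},-\tfrac{b}{a}\right)},$$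 $$\pi=\frac{\sqrt{2}\,a}{\sqrt{b(a+b)}}\,\frac{\mathbf{K}_{+}^{(a,b)}-\mathbf{K}_{-}^{(a,b)}}{\mathrm{F}_{D}^{(3)}\left(\tfrac32;\tfrac12;2\,\middle|\,-1,\tfrac{b}{a},-\tfrac{b}{a}\right)}.$$
   Context: For $|k|<1$, $\mathbf{K}(k)=\int_{0}^{1}\frac{\mathrm{d}u}{\sqrt{(1-u^{2})(1-k^{2}u^{2})}}$ is the complete elliptic integral of the first kind with modulus $k$. Lauricella function with equal $b$-parameters: for real $\alpha,\beta,\gamma$ with $\gamma>\alpha>0$ and $x_1,\dots,x_n\in\mathbb{C}\setminus[1,\infty)$, $\mathrm{F}_{D}^{(n)}(\alpha;\beta;\gamma\,|\,x_1,\dots,x_n)$ denotes the Lauricella function with $n$ parameters $b_1=\cdots=b_n=\beta$, given by the integral representation $$\mathrm{F}_{D}^{(n)}(\alpha;\beta;\gamma\,|\,x_1,\dots,x_n)=\frac{\Gamma(\gamma)}{\Gamma(\alpha)\Gamma(\gamma-\alpha)}\int_0^1\frac{u^{\alpha-1}(1-u)^{\gamma-\alpha-1}}{(1-x_1u)^{\beta}\cdots(1-x_nu)^{\beta}}\,\mathrm{d}u$$ (principal branches of the powers). It is the analytic continuation of the series $\sum_{m_1,\dots,m_n\ge0}\frac{(\alpha)_{m_1+\cdots+m_n}(\beta)_{m_1}\cdots(\beta)_{m_n}}{(\gamma)_{m_1+\cdots+m_n}\,m_1!\cdots m_n!}x_1^{m_1}\cdots x_n^{m_n}$, which converges for $|x_j|<1$,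 where $(\lambda)_m=\lambda(\lambda+1)\cdots(\lambda+m-1)$. *)

theory Defs
  imports "HOL-Analysis.Analysis"
begin

text \<open>
  Complete elliptic integral of the first kind as a function of the modulus (not of the
  parameter \<open>m = k\<^sup>2\<close>); meaningful for \<open>\<bar>k\<bar> < 1\<close>. The integrand is unbounded at \<open>u = 1\<close>,
  where division by zero assigns it the value 0; this does not affect the integral.
\<close>

definition elliptic_K :: "real \<Rightarrow> real" where
  "elliptic_K k = integral {0..1} (\<lambda>u. 1 / sqrt ((1 - u\<^sup>2) * (1 - k\<^sup>2 * u\<^sup>2)))"

definition K_plus :: "real \<Rightarrow> real \<Rightarrow> real" where
  "K_plus a b = elliptic_K ((sqrt a + sqrt b) / sqrt (2 * (a + b)))"

definition K_minus :: "real \<Rightarrow> real \<Rightarrow> real" where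
  "K_minus a b = elliptic_K ((sqrt a - sqrt b) / sqrt (2 * (a + b)))"

text \<open>
  \<open>lauricella_FD \<alpha> \<beta> \<gamma> [x\<^sub>1, \<dots>, x\<^sub>n]\<close> is the \<open>n\<close>-variable
  Lauricella function \<open>F\<^sub>D(\<alpha>; \<beta>; \<gamma> | x\<^sub>1, \<dots>, x\<^sub>n)\<close>, all \<open>b\<close>-parameters being
  equal to \<open>\<beta>\<close>; meaningful for \<open>\<gamma> > \<alpha> > 0\<close> and \<open>x\<^sub>j\<close> outside \<open>[1, \<infinity>)\<close>. Each factor
  \<open>1 - x\<^sub>j u\<close> is raised to its own principal power.
\<close>

definition lauricella_FD :: "real \<Rightarrow> real \<Rightarrow> real \<Rightarrow> complex list \<Rightarrow> complex" where
  "lauricella_FD \<alpha> \<beta> \<gamma> xs =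
     complex_of_real (Gamma \<gamma> / (Gamma \<alpha> * Gamma (\<gamma> - \<alpha>))) *
     integral {0..1} (\<lambda>u::real.
       complex_of_real (u powr (\<alpha> - 1) * (1 - u) powr (\<gamma> - \<alpha> - 1)) /
       (\<Prod>x\<leftarrow>xs. (1 - x * complex_of_real u) powr complex_of_real \<beta>))"

end

theory Submission
  imports Defs
begin

text \<open>
  All six integrals are hyperelliptic of genus two with an extra involution, and each reduces to
  elliptic integrals by substitution. With \<open>u = v\<^sup>2 / (1 + v\<^sup>2)\<close> the four-variable functions become
  \<open>\<integral>\<^sub>0\<^sup>\<infinity> v\<^sup>j / \<surd>((1 + a\<^sup>2 v\<^sup>4) (1 + b\<^sup>2 v\<^sup>4)) dv\<close> for \<open>j = 0, 2\<close>. The involution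
  \<open>v \<mapsto> 1 / (v \<surd>(a b))\<close> makes the two proportional, while the sum of the two integrals, suitably
  weighted, is a multiple of \<open>K\<^sub>-\<close>. With \<open>u = v\<^sup>2\<close> the last two three-variable functions become
  \<open>\<integral>\<^sub>0\<^sup>1 v\<^sup>j / \<surd>((1 - v\<^sup>4) (1 - s\<^sup>4 v\<^sup>4)) dv\<close> with \<open>s\<^sup>2 = b / a\<close>; here
  \<open>x = (1 \<mp> s) v / (1 \<mp> s v\<^sup>2)\<close> turns the combinations with numerators \<open>1 \<plusminus> s v\<^sup>2\<close> into
  multiples of \<open>K\<^sub>+\<close> and \<open>K\<^sub>-\<close>. The remaining two formulae follow from these by
  the Pfaff transformation \<open>u \<mapsto> 1 - u\<close>.
\<close>

section \<open>Change of variables on open intervals\<close>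

text \<open>
  For nonnegative integrands Henstock--Kurzweil integrability is absolute, so that existence of
  the integral on either side is part of the equivalence and need not be checked beforehand.
\<close>

lemma has_integral_change_of_variables_nonneg:
  fixes f g g' h :: "real \<Rightarrow> real"
  assumes S: "S \<in> sets lebesgue"
    and deriv: "\<And>x. x \<in> S \<Longrightarrow> (g has_field_derivative g' x) (at x)"
    and inj: "inj_on g S" and T: "g ` S = T"
    and nonneg: "\<And>y. y \<in> T \<Longrightarrow> 0 \<le> f y"
    and h: "\<And>x. x \<in> S \<Longrightarrow> h x = \<bar>g' x\<bar> * f (g x)"
  shows "(h has_integral I) S \<longleftrightarrow> (f has_integral I) T"
proof -
  have *: "(h has_integral I) S \<longleftrightarrow> ((\<lambda>x. \<bar>g' x\<bar> * f (g x)) has_integral I) S"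
    by (rule has_integral_cong) (simp add: h)
  have eq: "(\<lambda>x. \<bar>g' x\<bar> * f (g x)) absolutely_integrable_on S \<and>
        integral S (\<lambda>x. \<bar>g' x\<bar> * f (g x)) = I
      \<longleftrightarrow> f absolutely_integrable_on (g ` S) \<and> integral (g ` S) f = I"
    by (rule has_absolute_integral_change_of_variables_1'
        [OF S has_field_derivative_at_within[OF deriv] inj])
  have iff: "p absolutely_integrable_on A \<longleftrightarrow> p integrable_on A"
    if "\<And>x. x \<in> A \<Longrightarrow> 0 \<le> p x" for p :: "real \<Rightarrow> real" and A
    by (rule iffI) (erule set_lebesgue_integral_eq_integral(1), erule nonnegative_absolutely_integrable_1, erule that)
  have L: "(\<lambda>x. \<bar>g' x\<bar> * f (g x)) absolutely_integrable_on S \<longleftrightarrow>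
      (\<lambda>x. \<bar>g' x\<bar> * f (g x)) integrable_on S"
    by (rule iff, rule mult_nonneg_nonneg[OF abs_ge_zero nonneg]) (use T in blast)
  have R: "f absolutely_integrable_on T \<longleftrightarrow> f integrable_on T"
    using nonneg by (rule iff)
  show ?thesis
    using eq unfolding * L T R by (simp add: has_integral_iff)
qed

lemma image_greaterThanLessThan_strict_mono:
  fixes g :: "real \<Rightarrow> real"
  assumes "continuous_on {a..b} g" and "strict_mono_on {a..b} g" and "a < b"
  shows "g ` {a<..<b} = {g a<..<g b}"
proof
  show "g ` {a<..<b} \<subseteq> {g a<..<g b}"
    using assms(2,3) by (auto simp: strict_mono_on_def)
  show "{g a<..<g b} \<subseteq> g ` {a<..<b}"
  proof
    fix y assume y: "y \<in> {g a<..<g b}"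
    then have "g a \<le> y" "y \<le> g b" by simp_all
    then obtain x where x: "a \<le> x" "x \<le> b" "g x = y"
      using IVT'[of g a y b] assms(1,3) by fastforce
    with y have "x \<noteq> a" "x \<noteq> b" by auto
    with x show "y \<in> g ` {a<..<b}" by force
  qed
qed

section \<open>Trigonometric and complementary forms of the complete elliptic integral\<close>

lemma one_minus_mult_sin_squared_pos:
  fixes k \<phi> :: real
  assumes "k\<^sup>2 < 1"
  shows "0 < 1 - k\<^sup>2 * (sin \<phi>)\<^sup>2"
proof -
  have "k\<^sup>2 * (sin \<phi>)\<^sup>2 \<le> k\<^sup>2 * 1"
    by (intro mult_left_mono) (auto simp: abs_square_le_1)
  then show ?thesis using assms by simp
qed

text \<open>The substitution u = sin \<phi> removes the singularity at u = 1. The trigonometric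
  integrand is continuous on the closed interval, so its integral exists, and the change of
  variables carries this existence over to the unbounded integrand in the definition of
  \<open>elliptic_K\<close>.\<close>

lemma elliptic_K_has_integral_trig:
  assumes "k\<^sup>2 < 1"
  shows "((\<lambda>\<phi>. 1 / sqrt (1 - k\<^sup>2 * (sin \<phi>)\<^sup>2)) has_integral elliptic_K k) {0<..<pi/2}"
proof -
  note pos = one_minus_mult_sin_squared_pos[OF assms]
  have "continuous_on {0..pi/2} (\<lambda>\<phi>. 1 / sqrt (1 - k\<^sup>2 * (sin \<phi>)\<^sup>2))"
    using pos by (intro continuous_intros) (auto simp: less_imp_neq[symmetric])
  then have "(\<lambda>\<phi>. 1 / sqrt (1 - k\<^sup>2 * (sin \<phi>)\<^sup>2)) integrable_on {0..pi/2}"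
    by (rule integrable_continuous_real)
  then obtain I where I: "((\<lambda>\<phi>. 1 / sqrt (1 - k\<^sup>2 * (sin \<phi>)\<^sup>2)) has_integral I) {0<..<pi/2}"
    by (auto simp: integrable_on_def has_integral_Icc_iff_Ioo)
  have "((\<lambda>\<phi>. 1 / sqrt (1 - k\<^sup>2 * (sin \<phi>)\<^sup>2)) has_integral I) {0<..<pi/2} \<longleftrightarrow>
      ((\<lambda>u. 1 / sqrt ((1 - u\<^sup>2) * (1 - k\<^sup>2 * u\<^sup>2))) has_integral I) {0<..<1}"
  proof (rule has_integral_change_of_variables_nonneg[where g = sin and g' = cos])
    have "strict_mono_on {0..pi/2} sin"
      by (auto simp: strict_mono_on_def intro: sin_monotone_2pi)
    then show "sin ` {0<..<pi/2} = {0<..<1::real}"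
      using image_greaterThanLessThan_strict_mono[of 0 "pi/2" sin] by (simp add: continuous_intros)
    show "inj_on sin {0<..<pi/2}"
      using \<open>strict_mono_on {0..pi/2} sin\<close>
      by (rule inj_on_subset[OF strict_mono_on_imp_inj_on]) auto
    show "(0::real) \<le> 1 / sqrt ((1 - u\<^sup>2) * (1 - k\<^sup>2 * u\<^sup>2))" if "u \<in> {0<..<1}" for u
    proof -
      from that have "u\<^sup>2 \<le> 1" by (simp add: power_le_one)
      moreover from this assms have "k\<^sup>2 * u\<^sup>2 \<le> 1 * 1" by (intro mult_mono) auto
      ultimately show ?thesis by simp
    qed
    show "1 / sqrt (1 - k\<^sup>2 * (sin \<phi>)\<^sup>2) =
        \<bar>cos \<phi>\<bar> * (1 / sqrt ((1 - (sin \<phi>)\<^sup>2) * (1 - k\<^sup>2 * (sin \<phi>)\<^sup>2)))"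
      if "\<phi> \<in> {0<..<pi/2}" for \<phi>
    proof -
      have "cos \<phi> > 0" using that by (intro cos_gt_zero) auto
      moreover have "1 - (sin \<phi>)\<^sup>2 = (cos \<phi>)\<^sup>2" by (simp add: cos_squared_eq)
      ultimately show ?thesis by (simp add: real_sqrt_mult)
    qed
  qed (auto intro: DERIV_sin)
  with I have "((\<lambda>u. 1 / sqrt ((1 - u\<^sup>2) * (1 - k\<^sup>2 * u\<^sup>2))) has_integral I) {0..1}"
    by (simp add: has_integral_Icc_iff_Ioo)
  then have "elliptic_K k = I"
    unfolding elliptic_K_def by (rule integral_unique)
  with I show ?thesis by simp
qed

lemma elliptic_K_pos:
  assumes "k\<^sup>2 < 1"
  shows "0 < elliptic_K k"
proof -
  have "pi/2 \<le> elliptic_K k"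
  proof (rule has_integral_le[OF _ elliptic_K_has_integral_trig[OF assms]])
    show "((\<lambda>_. 1::real) has_integral pi/2) {0<..<pi/2}"
      using has_integral_const_real[of "1::real" 0 "pi/2"] by (simp add: has_integral_Icc_iff_Ioo)
    show "1 \<le> 1 / sqrt (1 - k\<^sup>2 * (sin \<phi>)\<^sup>2)" for \<phi>
      using one_minus_mult_sin_squared_pos[OF assms, of \<phi>] by simp
  qed
  then show ?thesis using pi_gt_zero by linarith
qed

text \<open>Substituting x = cos \<phi> brings in the squared complementary modulus 1 - k^2. This
  form suits moduli for which both k^2 and 1 - k^2 are explicit squares, as in the next
  lemma.\<close>

lemma elliptic_K_has_integral_complementary:
  assumes "k\<^sup>2 < 1"
  shows "((\<lambda>x. 1 / sqrt ((1 - x\<^sup>2) * (1 - k\<^sup>2 + k\<^sup>2 * x\<^sup>2))) has_integral elliptic_K k) {0<..<1}"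
proof -
  have "((\<lambda>\<phi>. 1 / sqrt (1 - k\<^sup>2 * (sin \<phi>)\<^sup>2)) has_integral elliptic_K k) {0<..<pi/2} \<longleftrightarrow>
      ((\<lambda>x. 1 / sqrt ((1 - x\<^sup>2) * (1 - k\<^sup>2 + k\<^sup>2 * x\<^sup>2))) has_integral elliptic_K k) {0<..<1}"
  proof (rule has_integral_change_of_variables_nonneg[where g = cos and g' = "\<lambda>\<phi>. - sin \<phi>"])
    show "cos ` {0<..<pi/2} = {0<..<1::real}"
    proof (intro equalityI subsetI)
      fix x :: real assume "x \<in> {0<..<1}"
      then show "x \<in> cos ` {0<..<pi/2}"
        by (intro image_eqI[where x = "arccos x"]) (auto simp: arccos_lt_bounded arccos_less_arccos
          intro!: arccos_less_arccos[of 0 x, simplified] arccos_less_arccos[of x 1, simplified])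
    next
      fix x :: real assume "x \<in> cos ` {0<..<pi/2}"
      then show "x \<in> {0<..<1}"
        using cos_monotone_0_pi[of 0] by (auto intro!: cos_gt_zero)
    qed
    show "inj_on cos {0<..<pi/2}"
      by (rule inj_onI) (auto intro!: cos_inj_pi)
    show "(0::real) \<le> 1 / sqrt ((1 - x\<^sup>2) * (1 - k\<^sup>2 + k\<^sup>2 * x\<^sup>2))" if "x \<in> {0<..<1}" for x
      using that assms by (simp add: power_le_one)
    show "1 / sqrt (1 - k\<^sup>2 * (sin \<phi>)\<^sup>2) =
        \<bar>- sin \<phi>\<bar> * (1 / sqrt ((1 - (cos \<phi>)\<^sup>2) * (1 - k\<^sup>2 + k\<^sup>2 * (cos \<phi>)\<^sup>2)))"
      if "\<phi> \<in> {0<..<pi/2}" for \<phi>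
    proof -
      have "sin \<phi> > 0" using that by (intro sin_gt_zero) auto
      moreover have "1 - (cos \<phi>)\<^sup>2 = (sin \<phi>)\<^sup>2"
          "1 - k\<^sup>2 + k\<^sup>2 * (cos \<phi>)\<^sup>2 = 1 - k\<^sup>2 * (sin \<phi>)\<^sup>2"
        by (simp_all add: cos_squared_eq algebra_simps)
      ultimately show ?thesis by (simp add: real_sqrt_mult)
    qed
  qed (auto intro!: derivative_eq_intros)
  then show ?thesis using elliptic_K_has_integral_trig[OF assms] by simp
qed

section \<open>Elliptic integrals with radicand (1 - v^4) (1 - s^4 v^4)\<close>

lemma elliptic_K_has_integral_quartic:
  assumes "\<bar>s\<bar> < 1"
  shows "((\<lambda>v. (1 + s * v\<^sup>2) / sqrt ((1 - v^4) * (1 - s^4 * v^4))) has_integral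
    elliptic_K ((1 + s) / sqrt (2 * (1 + s\<^sup>2))) / sqrt (2 * (1 + s\<^sup>2))) {0<..<1}"
proof -
  define n where "n = sqrt (2 * (1 + s\<^sup>2))"
  define k where "k = (1 + s) / n"
  have n: "n > 0" "n\<^sup>2 = 2 * (1 + s\<^sup>2)"
    by (auto simp: n_def add_pos_nonneg)
  \<comment> \<open>Hence (1 - s) / n is the complementary modulus of k.\<close>
  have "(1 + s)\<^sup>2 + (1 - s)\<^sup>2 = n\<^sup>2"
    unfolding n(2) by (simp add: power2_eq_square algebra_simps)
  then have k2: "k\<^sup>2 = (1 + s)\<^sup>2 / n\<^sup>2" "1 - k\<^sup>2 = (1 - s)\<^sup>2 / n\<^sup>2"
    using n(1) by (auto simp: k_def power_divide field_simps)
  have "(1 - s)\<^sup>2 / n\<^sup>2 > 0" using assms n(1) by simp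
  with k2 have k1: "k\<^sup>2 < 1" by linarith
  define g where "g v = (1 - s) * v / (1 - s * v\<^sup>2)" for v
  define g' where "g' v = (1 - s) * (1 + s * v\<^sup>2) / (1 - s * v\<^sup>2)\<^sup>2" for v
  have sv: "\<bar>s * v\<^sup>2\<bar> < 1" if "v \<in> {0..1}" for v
  proof -
    have "\<bar>s * v\<^sup>2\<bar> \<le> \<bar>s\<bar> * 1"
      using that unfolding abs_mult by (intro mult_left_mono) (auto simp: power_le_one)
    with assms show ?thesis by simp
  qed
  have svp: "0 < 1 - s * v\<^sup>2" "0 < 1 + s * v\<^sup>2" if "v \<in> {0..1}" for v
    using sv[OF that] by auto
  have der: "(g has_field_derivative g' v) (at v)" if "v \<in> {0..1}" for v
  proof -
    let ?d = "1 - s * v\<^sup>2"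
    have "((\<lambda>v. (1 - s) * v) has_field_derivative 1 - s) (at v)"
        "((\<lambda>v. 1 - s * v\<^sup>2) has_field_derivative - (2 * s * v)) (at v)"
      by (auto intro!: derivative_eq_intros)
    then have "(g has_field_derivative ((1 - s) * ?d - (1 - s) * v * - (2 * s * v)) / (?d * ?d)) (at v)"
      unfolding g_def[abs_def] using svp(1)[OF that] by (intro DERIV_divide) auto
    also have "(1 - s) * ?d - (1 - s) * v * - (2 * s * v) = (1 - s) * (1 + s * v\<^sup>2)"
      by (simp add: power2_eq_square algebra_simps)
    finally show ?thesis by (simp add: g'_def power2_eq_square)
  qed
  have g'_pos: "0 < g' v" if "v \<in> {0..1}" for v
    using svp[OF that] assms by (simp add: g'_def)
  have mono: "strict_mono_on {0..1} g"
  proof (rule strict_mono_onI)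
    fix u v :: real assume uv: "u \<in> {0..1}" "v \<in> {0..1}" "u < v"
    show "g u < g v"
    proof (rule DERIV_pos_imp_increasing[OF uv(3)])
      fix w assume "u \<le> w" "w \<le> v"
      with uv have "w \<in> {0..1}" by auto
      then show "\<exists>y. (g has_real_derivative y) (at w) \<and> 0 < y"
        using der g'_pos by blast
    qed
  qed
  have cont: "continuous_on {0..1} g"
    using der by (meson DERIV_isCont continuous_at_imp_continuous_on)
  have "((\<lambda>v. n * ((1 + s * v\<^sup>2) / sqrt ((1 - v^4) * (1 - s^4 * v^4)))) has_integral elliptic_K k) {0<..<1} \<longleftrightarrow>
      ((\<lambda>x. 1 / sqrt ((1 - x\<^sup>2) * (1 - k\<^sup>2 + k\<^sup>2 * x\<^sup>2))) has_integral elliptic_K k) {0<..<1}"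
  proof (rule has_integral_change_of_variables_nonneg[where g = g and g' = g'])
    show "g ` {0<..<1} = {0<..<1}"
      using image_greaterThanLessThan_strict_mono[OF cont mono] assms by (simp add: g_def)
    show "inj_on g {0<..<1}"
      using mono by (rule inj_on_subset[OF strict_mono_on_imp_inj_on]) auto
    show "(0::real) \<le> 1 / sqrt ((1 - x\<^sup>2) * (1 - k\<^sup>2 + k\<^sup>2 * x\<^sup>2))" if "x \<in> {0<..<1}" for x
      using that k1 by (simp add: power_le_one)
    show "n * ((1 + s * v\<^sup>2) / sqrt ((1 - v^4) * (1 - s^4 * v^4))) =
      \<bar>g' v\<bar> * (1 / sqrt ((1 - (g v)\<^sup>2) * (1 - k\<^sup>2 + k\<^sup>2 * (g v)\<^sup>2)))" if v: "v \<in> {0<..<1}" for v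
    proof -
      define d where "d = 1 - s * v\<^sup>2"
      have d: "d > 0" using svp(1)[of v] v by (auto simp: d_def)
      \<comment> \<open>The numerator d^2 - ((1 - s) v)^2 is a difference of squares with factors (1
        - v) (1 + s v) and (1 + v) (1 - s v).\<close>
      have 1: "1 - (g v)\<^sup>2 = (1 - v\<^sup>2) * (1 - s\<^sup>2 * v\<^sup>2) / d\<^sup>2"
        using d unfolding g_def d_def[symmetric] power_divide
        by (simp add: field_simps) (simp add: d_def eval_nat_numeral algebra_simps)
      have 2: "1 - k\<^sup>2 + k\<^sup>2 * (g v)\<^sup>2 = (1 - s)\<^sup>2 * ((1 + v\<^sup>2) * (1 + s\<^sup>2 * v\<^sup>2)) / (n\<^sup>2 * d\<^sup>2)"
      proof -
        \<comment> \<open>Brahmagupta's identity for the product of the sums of two squares 1 + v^2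
          and 1 + (s v)^2.\<close>
        have "(1 + v\<^sup>2) * (1 + s\<^sup>2 * v\<^sup>2) = d\<^sup>2 + ((1 + s) * v)\<^sup>2"
          by (simp add: d_def eval_nat_numeral algebra_simps)
        then show ?thesis
          unfolding k2(2) unfolding k2(1) using d n(1) unfolding g_def d_def[symmetric] power_divide
          by (simp add: power_mult_distrib distrib_left add_divide_distrib)
      qed
      have 3: "(1 - (g v)\<^sup>2) * (1 - k\<^sup>2 + k\<^sup>2 * (g v)\<^sup>2) =
          ((1 - s) / (n * d\<^sup>2))\<^sup>2 * ((1 - v^4) * (1 - s^4 * v^4))"
      proof -
        have "1 - v^4 = (1 - v\<^sup>2) * (1 + v\<^sup>2)" "1 - s^4 * v^4 = (1 - s\<^sup>2 * v\<^sup>2) * (1 + s\<^sup>2 * v\<^sup>2)"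
          by (simp_all add: eval_nat_numeral algebra_simps)
        then show ?thesis
          unfolding 1 2 by (simp add: power_mult_distrib power_divide power2_eq_square[of "d\<^sup>2"] ac_simps)
      qed
      have sqrt: "sqrt ((1 - (g v)\<^sup>2) * (1 - k\<^sup>2 + k\<^sup>2 * (g v)\<^sup>2)) =
          (1 - s) / (n * d\<^sup>2) * sqrt ((1 - v^4) * (1 - s^4 * v^4))"
        unfolding 3 using d n(1) assms by (simp add: real_sqrt_mult)
      have abs: "\<bar>g' v\<bar> = (1 - s) * (1 + s * v\<^sup>2) / d\<^sup>2"
        using g'_pos[of v] v unfolding d_def g'_def[symmetric] by simp
      show ?thesis unfolding sqrt abs using d n(1) assms by simp
    qed
  qed (use der in auto)
  then have "((\<lambda>v. n * ((1 + s * v\<^sup>2) / sqrt ((1 - v^4) * (1 - s^4 * v^4)))) has_integral elliptic_K k) {0<..<1}"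
    using elliptic_K_has_integral_complementary[OF k1] by simp
  from has_integral_mult_right[OF this, of "1/n"] show ?thesis
    unfolding n_def[symmetric] k_def[symmetric] using n by simp
qed

section \<open>Octic integrals over the half-line\<close>

lemma sqrt_square_mult: "sqrt ((p / q)\<^sup>2 * r) = \<bar>p\<bar> / \<bar>q\<bar> * sqrt r"
  by (simp add: real_sqrt_mult)

lemma octic_pos: "0 < (1 + a\<^sup>2 * v^4) * (1 + b\<^sup>2 * v^4)" for a b v :: real
  by (intro mult_pos_pos add_pos_nonneg mult_nonneg_nonneg) auto

text \<open>The integrand is even and has period pi, so four copies of the quarter-period integral
  fill the full turn. The open interval (-pi, pi) is the range of twice the arctangent.\<close>

lemma elliptic_K_has_integral_full_turn:
  assumes "k\<^sup>2 < 1"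
  shows "((\<lambda>\<phi>. 1 / sqrt (1 - k\<^sup>2 * (sin \<phi>)\<^sup>2)) has_integral 4 * elliptic_K k) {-pi<..<pi}"
proof -
  let ?f = "\<lambda>\<phi>. 1 / sqrt (1 - k\<^sup>2 * (sin \<phi>)\<^sup>2)"
  have 1: "(?f has_integral elliptic_K k) {0..pi/2}"
    using elliptic_K_has_integral_trig[OF assms] by (simp add: has_integral_Icc_iff_Ioo)
  then have "(?f has_integral elliptic_K k) {-(pi/2)..0}"
    using has_integral_reflect_lemma_real[OF 1] by (simp del: has_integral_reflect_real)
  then have 2: "(?f has_integral elliptic_K k) {pi/2..pi}"
    using has_integral_affinity'[of ?f "elliptic_K k" "-(pi/2)" 0 1 "-pi"]
    by (simp add: sin_diff)
  have 3: "(?f has_integral 2 * elliptic_K k) {0..pi}"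
    using has_integral_combine[OF _ _ 1 2] by simp
  then have 4: "(?f has_integral 2 * elliptic_K k) {-pi..0}"
    using has_integral_reflect_lemma_real[OF 3] by (simp del: has_integral_reflect_real)
  have "(?f has_integral 4 * elliptic_K k) {-pi..pi}"
    using has_integral_combine[OF _ _ 4 3] by simp
  then show ?thesis by (simp add: has_integral_Icc_iff_Ioo)
qed

text \<open>Supplies the range of the substitution for the octic integral. Prescribing the
  half-angle amounts to solving a quadratic equation for v whose roots have opposite signs.\<close>

lemma image_double_arctan:
  fixes c m :: real
  assumes "0 < c" "0 < m"
  shows "(\<lambda>v. 2 * arctan ((c * v\<^sup>2 - 1) / (m * v))) ` {0<..} = {-pi<..<pi}"
    (is "?g ` _ = _")
proof (intro equalityI subsetI)
  fix \<phi> assume "\<phi> \<in> ?g ` {0<..}"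
  then obtain y where "\<phi> = 2 * arctan y" by blast
  then show "\<phi> \<in> {-pi<..<pi}"
    using arctan_lbound[of y] arctan_ubound[of y] by simp
next
  fix \<phi> assume \<phi>: "\<phi> \<in> {-pi<..<pi}"
  \<comment> \<open>The equation to solve is c v^2 - t v - 1 = 0; r is the square root of its
    discriminant and v its positive root.\<close>
  define t where "t = m * tan (\<phi> / 2)"
  define r where "r = sqrt (t\<^sup>2 + 4 * c)"
  define v where "v = (t + r) / (2 * c)"
  have r2: "r\<^sup>2 = t\<^sup>2 + 4 * c" using assms by (simp add: r_def)
  have "\<bar>t\<bar> < r"
    unfolding r_def using assms by (intro real_less_rsqrt) simp
  then have v: "v > 0" using assms by (simp add: v_def)
  have "v * (2 * c) = t + r" using assms by (simp add: v_def)
  then have "(v * (2 * c) - t)\<^sup>2 = t\<^sup>2 + 4 * c" using r2 by simp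
  then have "4 * c * (c * v\<^sup>2 - 1) = 4 * c * (t * v)"
    by (simp add: power2_eq_square algebra_simps)
  then have "c * v\<^sup>2 - 1 = t * v" using assms by simp
  then have "(c * v\<^sup>2 - 1) / (m * v) = tan (\<phi> / 2)"
    using v assms by (simp add: t_def)
  then have "?g v = \<phi>" using \<phi> by (simp add: arctan_tan)
  with v show "\<phi> \<in> ?g ` {0<..}" by (intro image_eqI[where x = v]) auto
qed

text \<open>
  The substitution \<open>\<phi> = 2 arctan ((c v\<^sup>2 - 1) / (m v))\<close> composes two classical ones:
  \<open>w = y - 1/y\<close> with \<open>y = \<surd>c v\<close>, which exploits the symmetry \<open>y \<mapsto> 1/y\<close> of the palindromic octic
  and leaves a quartic in \<open>w\<close>, and \<open>w = (m / \<surd>c) tan (\<phi>/2)\<close>, which brings that quartic to Legendre form.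
\<close>

lemma elliptic_K_has_integral_octic:
  fixes a b :: real
  assumes "a > b" and "b > 0"
  defines "c \<equiv> sqrt (a * b)" and "m \<equiv> sqrt (a + b)"
  shows "((\<lambda>v. (c * v\<^sup>2 + 1) / sqrt ((1 + a\<^sup>2 * v^4) * (1 + b\<^sup>2 * v^4))) has_integral
    2 * K_minus a b / m) {0<..}"
proof -
  define k where "k = (sqrt a - sqrt b) / sqrt (2 * (a + b))"
  have cm: "c > 0" "c\<^sup>2 = a * b" "m > 0" "m\<^sup>2 = a + b"
    using assms by (auto simp: c_def m_def)
  \<comment> \<open>With d = 1 + h^2, this value turns d^2 - 4 k^2 h^2 below into 1 + h^4 + (4 c /
    m^2) h^2.\<close>
  have k2: "4 * k\<^sup>2 = 2 - 4 * c / m\<^sup>2"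
  proof -
    have "(sqrt a - sqrt b)\<^sup>2 = a + b - 2 * c"
      using assms by (simp add: power2_diff c_def real_sqrt_mult)
    moreover have "(sqrt (2 * (a + b)))\<^sup>2 = 2 * m\<^sup>2"
      using assms by (simp add: cm)
    ultimately have "k\<^sup>2 = (m\<^sup>2 - 2 * c) / (2 * m\<^sup>2)"
      unfolding k_def power_divide cm by simp
    then show ?thesis using cm(3) by (simp add: field_simps)
  qed
  have k1: "k\<^sup>2 < 1"
  proof -
    have "4 * c / m\<^sup>2 > 0" using cm(1,3) by simp
    with k2 show ?thesis by linarith
  qed
  define h where "h v = (c * v\<^sup>2 - 1) / (m * v)" for v
  define g where "g v = 2 * arctan (h v)" for v
  define g' where "g' v = 2 * ((c * v\<^sup>2 + 1) / (m * v\<^sup>2)) / (1 + (h v)\<^sup>2)" for v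
  have h_der: "(h has_field_derivative (c * v\<^sup>2 + 1) / (m * v\<^sup>2)) (at v)" if "v > 0" for v
  proof -
    have "((\<lambda>v. c * v\<^sup>2 - 1) has_field_derivative 2 * c * v) (at v)"
        "((\<lambda>v. m * v) has_field_derivative m) (at v)"
      by (auto intro!: derivative_eq_intros)
    then have "(h has_field_derivative (2 * c * v * (m * v) - (c * v\<^sup>2 - 1) * m) / (m * v * (m * v))) (at v)"
      unfolding h_def[abs_def] using that cm(3) by (intro DERIV_divide) auto
    also have "2 * c * v * (m * v) - (c * v\<^sup>2 - 1) * m = m * (c * v\<^sup>2 + 1)"
      by (simp add: power2_eq_square algebra_simps)
    finally show ?thesis using cm(3) by (simp add: power2_eq_square ac_simps)
  qed
  have der: "(g has_field_derivative g' v) (at v)" if "v > 0" for v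
    unfolding g_def[abs_def] g'_def using h_der[OF that]
    by (auto intro!: derivative_eq_intros simp: field_simps)
  have g'_pos: "g' v > 0" if "v > 0" for v
    using that cm by (simp add: g'_def add_pos_nonneg add_nonneg_pos)
  have mono: "g x < g y" if "0 < x" "x < y" for x y
    using DERIV_pos_imp_increasing[OF that(2), of g] der g'_pos that(1) by (meson less_le_trans)
  have "((\<lambda>v. 2 * m * ((c * v\<^sup>2 + 1) / sqrt ((1 + a\<^sup>2 * v^4) * (1 + b\<^sup>2 * v^4)))) has_integral 4 * elliptic_K k) {0<..} \<longleftrightarrow>
    ((\<lambda>\<phi>. 1 / sqrt (1 - k\<^sup>2 * (sin \<phi>)\<^sup>2)) has_integral 4 * elliptic_K k) {-pi<..<pi}"
  proof (rule has_integral_change_of_variables_nonneg[where g = g and g' = g'])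
    show "inj_on g {0<..}"
      by (rule linorder_inj_onI) (use mono in \<open>force\<close>)+
    show "g ` {0<..} = {-pi<..<pi}"
      using image_double_arctan[OF cm(1,3)] unfolding g_def h_def .
    show "0 \<le> 1 / sqrt (1 - k\<^sup>2 * (sin \<phi>)\<^sup>2)" for \<phi>
      using one_minus_mult_sin_squared_pos[OF k1, of \<phi>] by simp
    show "2 * m * ((c * v\<^sup>2 + 1) / sqrt ((1 + a\<^sup>2 * v^4) * (1 + b\<^sup>2 * v^4))) =
      \<bar>g' v\<bar> * (1 / sqrt (1 - k\<^sup>2 * (sin (g v))\<^sup>2))" if v: "v \<in> {0<..}" for v
    proof -
      define R where "R = (1 + a\<^sup>2 * v^4) * (1 + b\<^sup>2 * v^4)"
      define d where "d = 1 + (h v)\<^sup>2"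
      have v0: "v > 0" using v by simp
      have d: "d > 0" by (simp add: d_def add_pos_nonneg)
      have R: "R > 0" unfolding R_def by (rule octic_pos)
      have "sin (g v) = 2 * h v / d"
        unfolding g_def sin_double sin_arctan cos_arctan d_def
        by (simp add: power2_eq_square[symmetric])
      then have "(sin (g v))\<^sup>2 = 4 * (h v)\<^sup>2 / d\<^sup>2"
        by (simp add: power_divide power_mult_distrib)
      then have "1 - k\<^sup>2 * (sin (g v))\<^sup>2 = (d\<^sup>2 - 4 * k\<^sup>2 * (h v)\<^sup>2) / d\<^sup>2"
        using d by (simp add: field_simps)
      also have "d\<^sup>2 - 4 * k\<^sup>2 * (h v)\<^sup>2 = 1 + (h v)^4 + 4 * c / m\<^sup>2 * (h v)\<^sup>2"
        unfolding d_def k2 by (simp add: power2_eq_square power4_eq_xxxx algebra_simps)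
      also have "\<dots> = R / (m^4 * v^4)"
      proof -
        define x where "x = c * v\<^sup>2"
        define y where "y = m * v"
        have y: "y \<noteq> 0" using v0 cm(3) by (simp add: y_def)
        have "x\<^sup>2 = a * b * v^4" "y^4 = (a + b)\<^sup>2 * v^4"
          by (simp_all add: x_def y_def power_mult_distrib flip: cm(2,4) power_mult)
        \<comment> \<open>Brahmagupta's identity again, for 1 + (a v^2)^2 and 1 + (b v^2)^2. Then (x
          + 1)^2 = (x - 1)^2 + 4 x expresses the second square through x - 1 = y *
          \<open>h v\<close>.\<close>
        then have "R = y^4 + (x\<^sup>2 - 1)\<^sup>2"
          unfolding R_def by (simp add: power2_eq_square algebra_simps)
        also have "(x\<^sup>2 - 1)\<^sup>2 = (x - 1)^4 + 4 * x * (x - 1)\<^sup>2"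
          by (simp add: eval_nat_numeral algebra_simps)
        finally have R_eq: "R = y^4 + ((x - 1)^4 + 4 * x * (x - 1)\<^sup>2)" .
        have hv: "h v = (x - 1) / y" by (simp add: h_def x_def y_def)
        have "4 * c / m\<^sup>2 = 4 * x / y\<^sup>2" using v0 by (simp add: x_def y_def power_mult_distrib)
        then have "1 + (h v)^4 + 4 * c / m\<^sup>2 * (h v)\<^sup>2 = 1 + (x - 1)^4 / y^4 + 4 * x * (x - 1)\<^sup>2 / y^4"
          by (simp add: hv power_divide flip: power_add)
        also have "\<dots> = R / y^4"
          using y by (simp add: R_eq add_divide_distrib)
        finally show ?thesis by (simp add: y_def power_mult_distrib)
      qed
      finally have "1 - k\<^sup>2 * (sin (g v))\<^sup>2 = (1 / (m\<^sup>2 * v\<^sup>2 * d))\<^sup>2 * R"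
        by (simp add: power_mult_distrib power_divide flip: power_mult)
      then have sqrt: "sqrt (1 - k\<^sup>2 * (sin (g v))\<^sup>2) = 1 / (m\<^sup>2 * v\<^sup>2 * d) * sqrt R"
        using d by (simp only: sqrt_square_mult) simp
      have abs: "\<bar>g' v\<bar> = 2 * ((c * v\<^sup>2 + 1) / (m * v\<^sup>2)) / d"
        using g'_pos[OF v0] unfolding d_def g'_def[symmetric] by simp
      show ?thesis
        unfolding sqrt abs R_def[symmetric] using R d v0 cm(1,3)
        by (simp add: field_simps power2_eq_square)
    qed
  qed (use der in auto)
  then have "((\<lambda>v. 2 * m * ((c * v\<^sup>2 + 1) / sqrt ((1 + a\<^sup>2 * v^4) * (1 + b\<^sup>2 * v^4)))) has_integral 4 * elliptic_K k) {0<..}"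
    using elliptic_K_has_integral_full_turn[OF k1] by simp
  from has_integral_mult_right[OF this, of "1/(2*m)"] show ?thesis
    using cm unfolding K_minus_def k_def[symmetric] by simp
qed

text \<open>Separates the two summands of the preceding integral, which yield the four-variable
  functions with \<alpha> = 1/2 and \<alpha> = 3/2 respectively.\<close>

lemma has_integral_octic:
  fixes a b :: real
  assumes "a > b" and "b > 0"
  shows "((\<lambda>v. 1 / sqrt ((1 + a\<^sup>2 * v^4) * (1 + b\<^sup>2 * v^4))) has_integral
      K_minus a b / sqrt (a + b)) {0<..}"
    and "((\<lambda>v. v\<^sup>2 / sqrt ((1 + a\<^sup>2 * v^4) * (1 + b\<^sup>2 * v^4))) has_integral
      K_minus a b / sqrt (a * b * (a + b))) {0<..}"
proof -
  let ?K = "K_minus a b / sqrt (a + b)"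
  define c where "c = sqrt (a * b)"
  have c: "c > 0" "c\<^sup>2 = a * b" using assms by (auto simp: c_def)
  define R where "R v = (1 + a\<^sup>2 * v^4) * (1 + b\<^sup>2 * v^4)" for v
  define f where "f v = 1 / sqrt (R v)" for v
  define F where "F v = c * (v\<^sup>2 / sqrt (R v))" for v
  have pos: "0 < R v" for v
    unfolding R_def by (rule octic_pos)
  have f_nonneg: "0 \<le> f v" and F_nonneg: "0 \<le> F v" for v
    using pos[of v] c(1) by (auto simp: f_def F_def)
  have sum: "((\<lambda>v. F v + f v) has_integral 2 * ?K) {0<..}"
    using elliptic_K_has_integral_octic[OF assms] unfolding F_def f_def R_def c_def[symmetric]
    by (simp add: add_divide_distrib)
  \<comment> \<open>Integrability of a sum does not pass to its summands by itself; here
    \<open>f\<close> is measurable and, both summands being nonnegative, dominated by the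
    sum.\<close>
  have "f integrable_on {0<..}"
  proof (rule measurable_bounded_by_integrable_imp_integrable)
    have "continuous_on {0<..} R"
      unfolding R_def by (intro continuous_intros)
    then have "continuous_on {0<..} f"
      unfolding f_def using pos by (intro continuous_intros) (auto simp: less_imp_neq[symmetric])
    then show "f \<in> borel_measurable (lebesgue_on {0<..})"
      by (rule continuous_imp_measurable_on_sets_lebesgue) simp
    show "(\<lambda>v. F v + f v) integrable_on {0<..}" using sum by blast
    show "norm (f v) \<le> F v + f v" for v
      using f_nonneg[of v] F_nonneg[of v] by simp
  qed auto
  then obtain I where I: "(f has_integral I) {0<..}" by blast
  \<comment> \<open>The inversion \<open>v \<mapsto> 1 / (c v)\<close> interchanges the two summands, so each of them is half of \<open>sum\<close>.\<close>
  have "(F has_integral I) {0<..} \<longleftrightarrow> (f has_integral I) {0<..}"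
  proof (rule has_integral_change_of_variables_nonneg[where g = "\<lambda>v. 1 / (c * v)" and g' = "\<lambda>v. - 1 / (c * v\<^sup>2)"])
    show "(\<lambda>v. 1 / (c * v)) ` {0<..} = {0<..}"
    proof (intro equalityI subsetI)
      fix v :: real assume "v \<in> {0<..}"
      then show "v \<in> (\<lambda>v. 1 / (c * v)) ` {0<..}"
        using c(1) by (intro image_eqI[where x = "1 / (c * v)"]) auto
    qed (use c(1) in auto)
    show "((\<lambda>v. 1 / (c * v)) has_real_derivative - 1 / (c * v\<^sup>2)) (at v)" if "v \<in> {0<..}" for v
      using that c(1) by (auto intro!: derivative_eq_intros simp: field_simps power2_eq_square)
    show "inj_on (\<lambda>v. 1 / (c * v)) {0<..}"
      using c(1) by (auto intro!: inj_onI)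
    show "F v = \<bar>- 1 / (c * v\<^sup>2)\<bar> * f (1 / (c * v))" if "v \<in> {0<..}" for v
    proof -
      have v: "v > 0" using that by simp
      have "c^4 = (c\<^sup>2)\<^sup>2" by (simp flip: power_mult)
      then have c4: "(c * v)^4 = a\<^sup>2 * b\<^sup>2 * v^4"
        by (simp add: c(2) power_mult_distrib)
      \<comment> \<open>Since c^4 = a^2 b^2, the inversion exchanges the factors belonging to a and
        b, up to monomials.\<close>
      have "1 + a\<^sup>2 * (1 / (c * v))^4 = (1 + b\<^sup>2 * v^4) / (b\<^sup>2 * v^4)"
          "1 + b\<^sup>2 * (1 / (c * v))^4 = (1 + a\<^sup>2 * v^4) / (a\<^sup>2 * v^4)"
        unfolding power_divide c4 using v assms by (simp_all add: field_simps)
      then have "R (1 / (c * v)) = R v / ((b\<^sup>2 * v^4) * (a\<^sup>2 * v^4))"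
        by (simp add: R_def)
      also have "(b\<^sup>2 * v^4) * (a\<^sup>2 * v^4) = (c\<^sup>2 * v^4)\<^sup>2"
        by (simp add: c power_mult_distrib power2_eq_square[of "v^4"])
      finally have "sqrt (R (1 / (c * v))) = sqrt (R v) / (c\<^sup>2 * v^4)"
        by (simp add: real_sqrt_divide abs_mult)
      then show ?thesis
        using v c(1) by (simp add: F_def f_def eval_nat_numeral)
    qed
  qed (use f_nonneg in auto)
  with I have F: "(F has_integral I) {0<..}" by simp
  have "I + I = 2 * ?K"
    using has_integral_unique[OF has_integral_add[OF F I] sum] .
  then have IK: "I = ?K" by simp
  with I show "((\<lambda>v. 1 / sqrt ((1 + a\<^sup>2 * v^4) * (1 + b\<^sup>2 * v^4))) has_integral ?K) {0<..}"
    by (simp add: f_def[abs_def] R_def)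
  have "((\<lambda>v. 1 / c * F v) has_integral 1 / c * ?K) {0<..}"
    using has_integral_mult_right[OF F, of "1/c"] unfolding IK .
  moreover have "1 / c * F v = v\<^sup>2 / sqrt ((1 + a\<^sup>2 * v^4) * (1 + b\<^sup>2 * v^4))" for v
    using c(1) by (simp add: F_def R_def)
  moreover have "1 / c * ?K = K_minus a b / sqrt (a * b * (a + b))"
    by (simp add: c_def real_sqrt_mult)
  ultimately show "((\<lambda>v. v\<^sup>2 / sqrt ((1 + a\<^sup>2 * v^4) * (1 + b\<^sup>2 * v^4))) has_integral
      K_minus a b / sqrt (a * b * (a + b))) {0<..}"
    by (simp only:)
qed

section \<open>Lauricella functions as real integrals and the Pfaff transformation\<close>

text \<open>Where the product of complex powers is real, the defining integral is the image of a
  real one. Endpoints form a null set, so the open interval suffices, and the substitutions need not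
  reach 0 or 1.\<close>

lemma lauricella_FD_eqI:
  assumes "\<And>u. u \<in> {0<..<1} \<Longrightarrow>
      (\<Prod>x\<leftarrow>xs. (1 - x * complex_of_real u) powr complex_of_real \<beta>) = complex_of_real (d u)"
    and "((\<lambda>u. u powr (\<alpha> - 1) * (1 - u) powr (\<gamma> - \<alpha> - 1) / d u) has_integral I) {0<..<1}"
  shows "lauricella_FD \<alpha> \<beta> \<gamma> xs =
    complex_of_real (Gamma \<gamma> / (Gamma \<alpha> * Gamma (\<gamma> - \<alpha>)) * I)"
proof -
  have "((\<lambda>u. complex_of_real (u powr (\<alpha> - 1) * (1 - u) powr (\<gamma> - \<alpha> - 1)) /
      (\<Prod>x\<leftarrow>xs. (1 - x * complex_of_real u) powr complex_of_real \<beta>)) has_integral complex_of_real I) {0<..<1}"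
    using has_integral_of_real[OF assms(2), where 'b = complex]
    by (rule has_integral_eq[rotated]) (simp add: assms(1))
  then have "integral {0..1} (\<lambda>u. complex_of_real (u powr (\<alpha> - 1) * (1 - u) powr (\<gamma> - \<alpha> - 1)) /
      (\<Prod>x\<leftarrow>xs. (1 - x * complex_of_real u) powr complex_of_real \<beta>)) = complex_of_real I"
    by (intro integral_unique) (simp only: has_integral_Icc_iff_Ioo)
  then show ?thesis by (simp add: lauricella_FD_def)
qed

lemma one_minus_mult_pos:
  fixes x u :: real
  assumes "x < 1" "0 < u" "u < 1"
  shows "0 < 1 - x * u"
proof (cases "x \<le> 0")
  case True
  then have "x * u \<le> 0" using assms by (intro mult_nonpos_nonneg) auto
  then show ?thesis by simp
next
  case False
  then have "x * u < 1 * 1" using assms by (intro mult_strict_mono) auto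
  then show ?thesis by simp
qed

text \<open>For real x < 1 every base 1 - x u is positive, so its principal power is the real
  power.\<close>

lemma lauricella_FD_real:
  fixes xs :: "real list"
  assumes xs: "\<And>x. x \<in> set xs \<Longrightarrow> x < 1"
    and I: "((\<lambda>u. u powr (\<alpha> - 1) * (1 - u) powr (\<gamma> - \<alpha> - 1) /
      (\<Prod>x\<leftarrow>xs. (1 - x * u) powr \<beta>)) has_integral I) {0<..<1}"
  shows "lauricella_FD \<alpha> \<beta> \<gamma> (map complex_of_real xs) =
    complex_of_real (Gamma \<gamma> / (Gamma \<alpha> * Gamma (\<gamma> - \<alpha>)) * I)"
proof (rule lauricella_FD_eqI[OF _ I])
  fix u :: real assume u: "u \<in> {0<..<1}"
  show "(\<Prod>x\<leftarrow>map complex_of_real xs. (1 - x * complex_of_real u) powr complex_of_real \<beta>) =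
      complex_of_real (\<Prod>x\<leftarrow>xs. (1 - x * u) powr \<beta>)"
    using xs
  proof (induction xs)
    case (Cons x xs)
    have "(1 - complex_of_real x * complex_of_real u) powr complex_of_real \<beta> =
        complex_of_real ((1 - x * u) powr \<beta>)"
      using powr_of_real[of "1 - x * u" \<beta>] one_minus_mult_pos[of x u] Cons.prems u by simp
    with Cons show ?case by simp
  qed simp
qed

text \<open>Reflecting u to 1 - u exchanges \<alpha> with \<gamma> - \<alpha>, which leaves the
  Gamma prefactor unchanged, and 1 - x u / (x - 1) = (1 - x (1 - u)) / (1 - x) accounts for the new
  arguments and the product in front of I.\<close>

lemma lauricella_FD_Pfaff:
  fixes xs :: "real list"
  assumes xs: "\<And>x. x \<in> set xs \<Longrightarrow> x < 1"
    and I: "((\<lambda>u. u powr (\<alpha> - 1) * (1 - u) powr (\<gamma> - \<alpha> - 1) /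
      (\<Prod>x\<leftarrow>xs. (1 - x * u) powr \<beta>)) has_integral I) {0<..<1}" (is "(?f has_integral _) _")
  shows "lauricella_FD (\<gamma> - \<alpha>) \<beta> \<gamma> (map (\<lambda>x. complex_of_real (x / (x - 1))) xs) =
    complex_of_real (Gamma \<gamma> / (Gamma \<alpha> * Gamma (\<gamma> - \<alpha>)) * ((\<Prod>x\<leftarrow>xs. (1 - x) powr \<beta>) * I))"
proof -
  let ?ys = "map (\<lambda>x. x / (x - 1)) xs"
  have ys: "y < 1" if y: "y \<in> set ?ys" for y
  proof -
    obtain x where "x \<in> set xs" "y = x / (x - 1)" using y by auto
    with xs[of x] show ?thesis by (simp add: divide_less_eq)
  qed
  have prod: "(\<Prod>y\<leftarrow>?ys. (1 - y * u) powr \<beta>) =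
      (\<Prod>x\<leftarrow>xs. (1 - x * (1 - u)) powr \<beta>) / (\<Prod>x\<leftarrow>xs. (1 - x) powr \<beta>)"
    if u: "u \<in> {0<..<1}" for u
    using xs
  proof (induction xs)
    case (Cons x xs)
    have x: "x < 1" using Cons.prems by simp
    have "1 - x / (x - 1) * u = (1 - x * (1 - u)) / (1 - x)"
      using x by (simp add: field_simps)
    then have "(1 - x / (x - 1) * u) powr \<beta> = (1 - x * (1 - u)) powr \<beta> / (1 - x) powr \<beta>"
      using x u one_minus_mult_pos[of x "1 - u"] by (simp add: powr_divide)
    with Cons show ?case by simp
  qed simp
  have "((\<lambda>u. ?f (1 - u)) has_integral I) {0<..<1} \<longleftrightarrow> (?f has_integral I) {0<..<1}"
  proof (rule has_integral_change_of_variables_nonneg[where g = "\<lambda>u. 1 - u" and g' = "\<lambda>_. -1"])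
    show "(\<lambda>u. 1 - u) ` {0<..<1} = {0<..<1::real}"
      by (auto intro: image_eqI[where x = "1 - u" for u])
    show "0 \<le> ?f u" for u
    proof -
      have "0 \<le> (\<Prod>x\<leftarrow>xs. (1 - x * u) powr \<beta>)"
        by (rule prod_list_nonneg) auto
      then show ?thesis by simp
    qed
  qed (auto intro!: derivative_eq_intros inj_onI)
  with I have "((\<lambda>u. (\<Prod>x\<leftarrow>xs. (1 - x) powr \<beta>) * ?f (1 - u)) has_integral (\<Prod>x\<leftarrow>xs. (1 - x) powr \<beta>) * I) {0<..<1}"
    by (intro has_integral_mult_right) simp
  then have "((\<lambda>u. u powr (\<gamma> - \<alpha> - 1) * (1 - u) powr (\<gamma> - (\<gamma> - \<alpha>) - 1) /
      (\<Prod>y\<leftarrow>?ys. (1 - y * u) powr \<beta>)) has_integral (\<Prod>x\<leftarrow>xs. (1 - x) powr \<beta>) * I) {0<..<1}"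
    by (rule has_integral_eq[rotated]) (simp only: prod, simp)
  from lauricella_FD_real[OF ys this] show ?thesis
    by (simp add: o_def mult.commute)
qed

section \<open>Four-variable functions at conjugate pairs of arguments\<close>

text \<open>A positive real part keeps z off the branch cut, where the principal square root
  commutes with conjugation; the product is therefore the squared modulus of that root.\<close>

lemma powr_half_mult_cnj: "z powr (1/2) * cnj z powr (1/2) = complex_of_real (cmod z)"
  if "0 < Re z"
proof -
  have "cnj z powr (1/2) = cnj (z powr (1/2))"
    using cnj_powr[of z "1/2"] that by simp
  then have "z powr (1/2) * cnj z powr (1/2) = complex_of_real ((cmod (z powr (1/2)))\<^sup>2)"
    by (simp add: complex_mult_cnj cmod_power2)
  then show ?thesis
    by (simp add: csqrt_conv_powr[symmetric] norm_csqrt)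
qed

lemma powr_half_conjugate_factors:
  fixes a u :: real
  assumes "u < 1"
  shows "(1 - (1 + \<i> * complex_of_real a) * complex_of_real u) powr (1/2) *
      (1 - (1 - \<i> * complex_of_real a) * complex_of_real u) powr (1/2) =
    complex_of_real (sqrt ((1 - u)\<^sup>2 + a\<^sup>2 * u\<^sup>2))"
proof -
  let ?z = "Complex (1 - u) (- a * u)"
  have "1 - (1 + \<i> * complex_of_real a) * complex_of_real u = ?z"
      "1 - (1 - \<i> * complex_of_real a) * complex_of_real u = cnj ?z"
    by (simp_all add: complex_eq_iff)
  then show ?thesis
    using powr_half_mult_cnj[of ?z] assms by (simp add: complex_norm power_mult_distrib)
qed

text \<open>The division by v is left explicit so that it cancels the factor v in the derivative of
  substitutions built on v^2.\<close>

lemma square_powr_minus_one: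
  fixes v :: real
  assumes "0 < v"
  shows "(v\<^sup>2) powr (\<alpha> - 1) = v powr (2 * \<alpha> - 1) / v"
  using assms powr_powr[of v 2 "\<alpha> - 1"] powr_diff[of v "2 * \<alpha> - 1" 1]
  by (simp add: algebra_simps)

text \<open>Put u = v^2 / (1 + v^2), so that 1 - u = 1 / (1 + v^2). Each conjugate pair contributes
  sqrt (1 + a^2 v^4) / (1 + v^2), or the same with b, and for \<gamma> = 2 all powers of 1 + v^2
  cancel. The factor 2 comes from the derivative.\<close>

lemma lauricella_FD_conjugate_pairs:
  fixes a b :: real
  assumes I: "((\<lambda>v. v powr (2 * \<alpha> - 1) / sqrt ((1 + a\<^sup>2 * v^4) * (1 + b\<^sup>2 * v^4))) has_integral I) {0<..}"
  shows "lauricella_FD \<alpha> (1/2) 2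
      [1 + \<i> * complex_of_real a, 1 - \<i> * complex_of_real a,
       1 + \<i> * complex_of_real b, 1 - \<i> * complex_of_real b] =
    complex_of_real (2 * I / (Gamma \<alpha> * Gamma (2 - \<alpha>)))"
proof -
  define d where "d u = sqrt ((1 - u)\<^sup>2 + a\<^sup>2 * u\<^sup>2) * sqrt ((1 - u)\<^sup>2 + b\<^sup>2 * u\<^sup>2)" for u
  have "((\<lambda>v. 2 * (v powr (2 * \<alpha> - 1) / sqrt ((1 + a\<^sup>2 * v^4) * (1 + b\<^sup>2 * v^4)))) has_integral 2 * I) {0<..} \<longleftrightarrow>
     ((\<lambda>u. u powr (\<alpha> - 1) * (1 - u) powr (2 - \<alpha> - 1) / d u) has_integral 2 * I) {0<..<1}"
  proof (rule has_integral_change_of_variables_nonneg[where g = "\<lambda>v. v\<^sup>2 / (1 + v\<^sup>2)"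
        and g' = "\<lambda>v. 2 * v / (1 + v\<^sup>2)\<^sup>2"])
    have pos: "0 < 1 + v\<^sup>2" for v :: real by (simp add: add_pos_nonneg)
    show "((\<lambda>v. v\<^sup>2 / (1 + v\<^sup>2)) has_real_derivative 2 * v / (1 + v\<^sup>2)\<^sup>2) (at v)" for v
      using pos[of v] by (auto intro!: derivative_eq_intros simp: field_simps eval_nat_numeral)
    show "inj_on (\<lambda>v::real. v\<^sup>2 / (1 + v\<^sup>2)) {0<..}"
    proof (rule inj_onI)
      fix v w :: real assume "v \<in> {0<..}" "w \<in> {0<..}" "v\<^sup>2 / (1 + v\<^sup>2) = w\<^sup>2 / (1 + w\<^sup>2)"
      then show "v = w" using pos[of v] pos[of w] by (simp add: field_simps)
    qed
    show "(\<lambda>v::real. v\<^sup>2 / (1 + v\<^sup>2)) ` {0<..} = {0<..<1}"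
    proof (intro equalityI subsetI)
      fix u :: real assume "u \<in> {0<..<1}"
      then show "u \<in> (\<lambda>v::real. v\<^sup>2 / (1 + v\<^sup>2)) ` {0<..}"
        by (intro image_eqI[where x = "sqrt (u / (1 - u))"]) (auto simp: field_simps)
    qed (use pos in auto)
    show "0 \<le> u powr (\<alpha> - 1) * (1 - u) powr (2 - \<alpha> - 1) / d u" for u
      by (simp add: d_def)
    show "2 * (v powr (2 * \<alpha> - 1) / sqrt ((1 + a\<^sup>2 * v^4) * (1 + b\<^sup>2 * v^4))) =
        \<bar>2 * v / (1 + v\<^sup>2)\<^sup>2\<bar> * ((v\<^sup>2 / (1 + v\<^sup>2)) powr (\<alpha> - 1) *
          (1 - v\<^sup>2 / (1 + v\<^sup>2)) powr (2 - \<alpha> - 1) / d (v\<^sup>2 / (1 + v\<^sup>2)))"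
      if "v \<in> {0<..}" for v
    proof -
      define e where "e = 1 + v\<^sup>2"
      have e: "e > 0" using pos by (simp add: e_def)
      have v: "v > 0" using that by simp
      have 1: "1 - v\<^sup>2 / e = 1 / e" using e by (simp add: field_simps) (simp add: e_def)
      have fac: "sqrt ((1 / e)\<^sup>2 + x\<^sup>2 * (v\<^sup>2 / e)\<^sup>2) = sqrt (1 + x\<^sup>2 * v^4) / e" for x
      proof -
        have "(1 / e)\<^sup>2 + x\<^sup>2 * (v\<^sup>2 / e)\<^sup>2 = (1 + x\<^sup>2 * v^4) / e\<^sup>2"
          by (simp add: power_divide add_divide_distrib flip: power_mult)
        then show ?thesis using e by (simp add: real_sqrt_divide)
      qed
      have "(v\<^sup>2 / e) powr (\<alpha> - 1) * (1 / e) powr (2 - \<alpha> - 1) = (v\<^sup>2) powr (\<alpha> - 1)"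
      proof -
        have "(1 / e) powr (2 - \<alpha> - 1) = e powr (\<alpha> - 1)"
          using e by (simp add: powr_divide powr_diff field_simps)
        then show ?thesis using e by (simp add: powr_divide)
      qed
      also have "\<dots> = v powr (2 * \<alpha> - 1) / v"
        using v by (rule square_powr_minus_one)
      finally have pw: "(v\<^sup>2 / e) powr (\<alpha> - 1) * (1 / e) powr (2 - \<alpha> - 1) = v powr (2 * \<alpha> - 1) / v" .
      have "\<bar>2 * v / e\<^sup>2\<bar> = 2 * v / e\<^sup>2" using v by simp
      then show ?thesis
        unfolding e_def[symmetric] 1 pw d_def fac
        using e v by (simp add: real_sqrt_mult power2_eq_square)
    qed
  qed auto
  with has_integral_mult_right[OF I, of 2]
  have "((\<lambda>u. u powr (\<alpha> - 1) * (1 - u) powr (2 - \<alpha> - 1) / d u) has_integral 2 * I) {0<..<1}" by simp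
  note lauricella_FD_eqI[OF _ this]
  moreover have "(\<Prod>x\<leftarrow>[1 + \<i> * complex_of_real a, 1 - \<i> * complex_of_real a,
        1 + \<i> * complex_of_real b, 1 - \<i> * complex_of_real b].
      (1 - x * complex_of_real u) powr complex_of_real (1/2)) = complex_of_real (d u)"
    if "u \<in> {0<..<1}" for u
  proof -
    have "u < 1" using that by simp
    note factors = powr_half_conjugate_factors[OF this]
    show ?thesis
      using factors[of a] factors[of b] by (simp add: d_def flip: mult.assoc)
  qed
  moreover have "Gamma (2::real) = 1"
    using Gamma_fact[of 1, where 'a = real] by simp
  ultimately show ?thesis by simp
qed

section \<open>Three-variable functions and the sum and difference of \<open>K_plus\<close> and
  \<open>K_minus\<close>\<close>

text \<open>The quartic integrals for s = sqrt (b / a) and for -s have numerators 1 + s v^2 and 1 -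
  s v^2 over the same root. Half their sum isolates 1, and their difference divided by 2 s isolates
  v^2.\<close>

lemma K_plus_minus_has_integral:
  fixes a b :: real
  assumes "a > b" and "b > 0"
  shows "((\<lambda>v. 1 / sqrt ((1 - v^4) * (1 - (b/a)\<^sup>2 * v^4))) has_integral
      sqrt a * (K_plus a b + K_minus a b) / (2 * sqrt (2 * (a + b)))) {0<..<1}"
    and "((\<lambda>v. v\<^sup>2 / sqrt ((1 - v^4) * (1 - (b/a)\<^sup>2 * v^4))) has_integral
      a * (K_plus a b - K_minus a b) / (2 * sqrt b * sqrt (2 * (a + b)))) {0<..<1}"
proof -
  define s where "s = sqrt (b / a)"
  define R where "R v = sqrt ((1 - v^4) * (1 - (b/a)\<^sup>2 * v^4))" for v
  define n where "n = sqrt (2 * (1 + s\<^sup>2))"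
  have s2: "s\<^sup>2 = b / a" using assms by (simp add: s_def)
  have "s^4 = (s\<^sup>2)\<^sup>2" by (simp flip: power_mult)
  then have s4: "s^4 = (b/a)\<^sup>2" by (simp add: s2)
  have s: "0 < s" "s < 1" using assms by (auto simp: s_def)
  have sa: "s = sqrt b / sqrt a" by (simp add: s_def real_sqrt_divide)
  have "2 * (1 + s\<^sup>2) = 2 * (a + b) / a"
    unfolding s2 using assms by (simp add: field_simps)
  then have n: "n = sqrt (2 * (a + b)) / sqrt a"
    by (simp add: n_def real_sqrt_divide)
  have "(1 + s) / n = (sqrt a + sqrt b) / sqrt (2 * (a + b))"
      "(1 - s) / n = (sqrt a - sqrt b) / sqrt (2 * (a + b))"
    unfolding n sa using assms by (simp_all add: field_simps)
  then have K: "K_plus a b = elliptic_K ((1 + s) / n)" "K_minus a b = elliptic_K ((1 - s) / n)"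
    by (simp_all add: K_plus_def K_minus_def)
  have P: "((\<lambda>v. (1 + s * v\<^sup>2) / R v) has_integral K_plus a b / n) {0<..<1}"
    using elliptic_K_has_integral_quartic[of s] s unfolding K n_def R_def s4 by simp
  have M: "((\<lambda>v. (1 - s * v\<^sup>2) / R v) has_integral K_minus a b / n) {0<..<1}"
    using elliptic_K_has_integral_quartic[of "- s"] s unfolding K n_def R_def power2_minus s4 by (simp add: s4)
  have "((\<lambda>v. 1/2 * ((1 + s * v\<^sup>2) / R v + (1 - s * v\<^sup>2) / R v)) has_integral
      1/2 * (K_plus a b / n + K_minus a b / n)) {0<..<1}"
    by (intro has_integral_mult_right has_integral_add P M)
  moreover have "1/2 * ((1 + s * v\<^sup>2) / R v + (1 - s * v\<^sup>2) / R v) = 1 / R v" for v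
    by (simp flip: add_divide_distrib)
  moreover have "1/2 * (K_plus a b / n + K_minus a b / n) =
      sqrt a * (K_plus a b + K_minus a b) / (2 * sqrt (2 * (a + b)))"
    unfolding n by (simp add: add_divide_distrib ring_distribs mult.commute)
  ultimately show "((\<lambda>v. 1 / sqrt ((1 - v^4) * (1 - (b/a)\<^sup>2 * v^4))) has_integral
      sqrt a * (K_plus a b + K_minus a b) / (2 * sqrt (2 * (a + b)))) {0<..<1}"
    unfolding R_def by (simp only:)
  have "((\<lambda>v. 1/(2 * s) * ((1 + s * v\<^sup>2) / R v - (1 - s * v\<^sup>2) / R v)) has_integral
      1/(2 * s) * (K_plus a b / n - K_minus a b / n)) {0<..<1}"
    by (intro has_integral_mult_right has_integral_diff P M)
  moreover have "1/(2 * s) * ((1 + s * v\<^sup>2) / R v - (1 - s * v\<^sup>2) / R v) = v\<^sup>2 / R v" for v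
    using s by (simp flip: diff_divide_distrib)
  moreover have "1/(2 * s) * (K_plus a b / n - K_minus a b / n) =
      a * (K_plus a b - K_minus a b) / (2 * sqrt b * sqrt (2 * (a + b)))"
  proof -
    have "1/(2 * s) * (K_plus a b / n - K_minus a b / n) = (K_plus a b - K_minus a b) / (2 * (s * n))"
      by (simp flip: diff_divide_distrib)
    also have "s * n = sqrt b * sqrt (2 * (a + b)) / a"
      unfolding n sa using assms by simp
    finally show ?thesis by (simp add: ac_simps)
  qed
  ultimately show "((\<lambda>v. v\<^sup>2 / sqrt ((1 - v^4) * (1 - (b/a)\<^sup>2 * v^4))) has_integral
      a * (K_plus a b - K_minus a b) / (2 * sqrt b * sqrt (2 * (a + b)))) {0<..<1}"
    unfolding R_def by (simp only:)
qed

text \<open>Makes the numerators of all six quotients nonzero, from which the denominators will be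
  seen not to vanish. The difference is a positive multiple of the integral of a positive
  function.\<close>

lemma K_plus_minus_pos:
  fixes a b :: real
  assumes "a > b" and "b > 0"
  shows "0 < K_minus a b" "0 < K_plus a b - K_minus a b"
proof -
  have "((sqrt a - sqrt b) / sqrt (2 * (a + b)))\<^sup>2 < 1"
  proof -
    have "(sqrt a - sqrt b)\<^sup>2 \<le> a + b"
      using assms by (simp add: power2_diff)
    then show ?thesis using assms by (simp add: power_divide)
  qed
  then show "0 < K_minus a b"
    unfolding K_minus_def by (rule elliptic_K_pos)
  \<comment> \<open>The radicand is at most 1, so the integrand is at least v^2, which lies above
    its tangent v - 1/4 at v = 1/2; that tangent has integral 1/4.\<close>
  have "1/4 \<le> a * (K_plus a b - K_minus a b) / (2 * sqrt b * sqrt (2 * (a + b)))"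
  proof (rule has_integral_le[OF _ K_plus_minus_has_integral(2)[OF assms]])
    have "((\<lambda>v::real. v - 1/4) has_integral 1/4) {0..1}"
      using has_integral_diff[OF ident_has_integral[of 0 "1::real"] has_integral_const_real[of "1/4::real" 0 1]]
      by simp
    then show "((\<lambda>v::real. v - 1/4) has_integral 1/4) {0<..<1}"
      by (simp add: has_integral_Icc_iff_Ioo)
    fix v :: real assume v: "v \<in> {0<..<1}"
    have v4: "0 < 1 - v^4" "1 - v^4 \<le> 1"
      using v power_Suc_less_one[of v 3] by auto
    have "(b/a)\<^sup>2 < 1" using assms by (simp add: power_less_one_iff)
    then have "(b/a)\<^sup>2 * v^4 < 1 * 1"
      using v4 by (intro mult_strict_mono) auto
    then have q: "0 < 1 - (b/a)\<^sup>2 * v^4" "1 - (b/a)\<^sup>2 * v^4 \<le> 1" by simp_all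
    have R0: "0 < (1 - v^4) * (1 - (b/a)\<^sup>2 * v^4)" using v4 q by (intro mult_pos_pos)
    have R1: "(1 - v^4) * (1 - (b/a)\<^sup>2 * v^4) \<le> 1"
      using mult_le_one[OF v4(2) less_imp_le[OF q(1)] q(2)] .
    have "v - 1/4 \<le> v\<^sup>2"
      using zero_le_power2[of "v - 1/2"] by (simp add: power2_eq_square algebra_simps)
    also have "\<dots> = v\<^sup>2 / 1" by simp
    also have "\<dots> \<le> v\<^sup>2 / sqrt ((1 - v^4) * (1 - (b/a)\<^sup>2 * v^4))"
      using R1 by (intro divide_left_mono mult_pos_pos real_sqrt_gt_zero R0) auto
    finally show "v - 1/4 \<le> v\<^sup>2 / sqrt ((1 - v^4) * (1 - (b/a)\<^sup>2 * v^4))" .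
  qed
  then have "0 < a * (K_plus a b - K_minus a b) / (2 * sqrt b * sqrt (2 * (a + b)))"
    by simp
  moreover have "0 < 2 * sqrt b * sqrt (2 * (a + b))" using assms by simp
  ultimately have "0 < a * (K_plus a b - K_minus a b)"
    by (simp only: zero_less_divide_iff) linarith
  then show "0 < K_plus a b - K_minus a b"
    using assms by (simp add: zero_less_mult_iff)
qed

text \<open>Under u = v^2 the radicand splits into 1 - v^2, 1 + v^2, 1 - q v^2 and 1 + q v^2. The
  choice \<gamma> = \<alpha> + 1/2 produces the first factor through (1 - u) powr (-1/2); the
  arguments -1, q, -q produce the others.\<close>

lemma has_integral_powr_quartic:
  fixes q :: real
  assumes "\<bar>q\<bar> < 1"
    and I: "((\<lambda>v. v powr (2 * \<alpha> - 1) / sqrt ((1 - v^4) * (1 - q\<^sup>2 * v^4))) has_integral I) {0<..<1}"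
  shows "((\<lambda>u. u powr (\<alpha> - 1) * (1 - u) powr ((\<alpha> + 1/2) - \<alpha> - 1) /
      (\<Prod>x\<leftarrow>[-1, q, - q]. (1 - x * u) powr (1/2))) has_integral 2 * I) {0<..<1}"
proof -
  have "((\<lambda>v. 2 * (v powr (2 * \<alpha> - 1) / sqrt ((1 - v^4) * (1 - q\<^sup>2 * v^4)))) has_integral 2 * I) {0<..<1} \<longleftrightarrow>
    ((\<lambda>u. u powr (\<alpha> - 1) * (1 - u) powr ((\<alpha> + 1/2) - \<alpha> - 1) /
      (\<Prod>x\<leftarrow>[-1, q, - q]. (1 - x * u) powr (1/2))) has_integral 2 * I) {0<..<1}"
  proof (rule has_integral_change_of_variables_nonneg[where g = "\<lambda>v. v\<^sup>2" and g' = "\<lambda>v. 2 * v"])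
    show "(\<lambda>v::real. v\<^sup>2) ` {0<..<1} = {0<..<1}"
    proof (intro equalityI subsetI)
      fix u :: real assume "u \<in> {0<..<1}"
      then show "u \<in> (\<lambda>v. v\<^sup>2) ` {0<..<1}"
        by (intro image_eqI[where x = "sqrt u"]) auto
    qed (auto simp: power_less_one_iff)
    show "inj_on (\<lambda>v::real. v\<^sup>2) {0<..<1}"
      by (rule inj_onI) simp
    show "0 \<le> u powr (\<alpha> - 1) * (1 - u) powr ((\<alpha> + 1/2) - \<alpha> - 1) /
      (\<Prod>x\<leftarrow>[-1, q, - q]. (1 - x * u) powr (1/2))" for u
      by simp
    show "2 * (v powr (2 * \<alpha> - 1) / sqrt ((1 - v^4) * (1 - q\<^sup>2 * v^4))) =
        \<bar>2 * v\<bar> * ((v\<^sup>2) powr (\<alpha> - 1) * (1 - v\<^sup>2) powr ((\<alpha> + 1/2) - \<alpha> - 1) /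
          (\<Prod>x\<leftarrow>[-1, q, - q]. (1 - x * v\<^sup>2) powr (1/2)))" if "v \<in> {0<..<1}" for v
    proof -
      have v: "0 < v" "v < 1" using that by auto
      have v2: "0 < v\<^sup>2" "v\<^sup>2 < 1" using v by (auto simp: power_less_one_iff)
      have q: "0 < 1 - q * v\<^sup>2" "0 < 1 + q * v\<^sup>2"
        using one_minus_mult_pos[of q "v\<^sup>2"] one_minus_mult_pos[of "- q" "v\<^sup>2"] assms(1) v2 by auto
      have pw: "(v\<^sup>2) powr (\<alpha> - 1) = v powr (2 * \<alpha> - 1) / v"
        using v(1) by (rule square_powr_minus_one)
      have pm: "(1 - v\<^sup>2) powr ((\<alpha> + 1/2) - \<alpha> - 1) = 1 / sqrt (1 - v\<^sup>2)"
        using v2 powr_minus_divide[of "1 - v\<^sup>2" "1/2"] by (simp add: powr_half_sqrt)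
      have pr: "(\<Prod>x\<leftarrow>[-1, q, - q]. (1 - x * v\<^sup>2) powr (1/2)) =
          sqrt (1 + v\<^sup>2) * (sqrt (1 - q * v\<^sup>2) * sqrt (1 + q * v\<^sup>2))"
        using q v2 by (simp add: powr_half_sqrt)
      have "(1 - v^4) * (1 - q\<^sup>2 * v^4) =
          (1 - v\<^sup>2) * ((1 + v\<^sup>2) * ((1 - q * v\<^sup>2) * (1 + q * v\<^sup>2)))"
        by (simp add: eval_nat_numeral algebra_simps)
      then have R: "sqrt ((1 - v^4) * (1 - q\<^sup>2 * v^4)) =
          sqrt (1 - v\<^sup>2) * (sqrt (1 + v\<^sup>2) * (sqrt (1 - q * v\<^sup>2) * sqrt (1 + q * v\<^sup>2)))"
        by (simp add: real_sqrt_mult)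
      show ?thesis unfolding pw pm pr R using v by simp
    qed
  qed (auto intro!: derivative_eq_intros)
  with has_integral_mult_right[OF I, of 2] show ?thesis by simp
qed

section \<open>Assembly of the six formulae\<close>

text \<open>Common shape of the six conclusions. That the denominator is nonzero is deduced from the
  product equation, whose right-hand side does not vanish.\<close>

lemma pi_eq_quotientI:
  assumes "F = complex_of_real f" and "pi * f = c * X" and "c * X \<noteq> 0"
  shows "complex_of_real pi = complex_of_real c * (complex_of_real X / F)"
proof -
  have "f \<noteq> 0" using assms(2,3) by auto
  with assms(2) have "pi = c * (X / f)" by (simp add: field_simps)
  then show ?thesis
    unfolding assms(1) by (simp flip: of_real_mult of_real_divide)
qed

lemma Gamma_three_halves_real: "Gamma (3/2 :: real) = sqrt pi / 2"
proof -
  have "(1/2 :: real) \<notin> \<int>\<^sub>\<le>\<^sub>0" by (auto dest: nonpos_Ints_nonpos)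
  then show ?thesis
    using Gamma_plus1[of "1/2 :: real"] by (simp add: Gamma_one_half_real)
qed

theorem theorem3p1:
  fixes a b :: real
  assumes "a > b" and "b > 0"
  shows
    "(complex_of_real pi =
       complex_of_real (4 / sqrt (a * b * (a + b))) *
       (complex_of_real (K_minus a b) /
        lauricella_FD (3/2) (1/2) 2
          [1 + \<i> * complex_of_real a, 1 - \<i> * complex_of_real a,
           1 + \<i> * complex_of_real b, 1 - \<i> * complex_of_real b])) \<and>
     (complex_of_real pi =
       complex_of_real (4 / sqrt (a + b)) *
       (complex_of_real (K_minus a b) /
        lauricella_FD (1/2) (1/2) 2
          [1 + \<i> * complex_of_real a, 1 - \<i> * complex_of_real a,
           1 + \<i> * complex_of_real b, 1 - \<i> * complex_of_real b])) \<and>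
     (complex_of_real pi =
       complex_of_real (2 * sqrt (a - b) / sqrt b) *
       (complex_of_real (K_plus a b - K_minus a b) /
        lauricella_FD (1/2) (1/2) 2
          [1/2, complex_of_real (b / (a + b)), complex_of_real (b / (b - a))])) \<and>
     (complex_of_real pi =
       complex_of_real (sqrt (a - b) / sqrt a) *
       (complex_of_real (K_plus a b + K_minus a b) /
        lauricella_FD (1/2) (1/2) 1
          [1/2, complex_of_real (b / (a + b)), complex_of_real (b / (b - a))])) \<and>
     (complex_of_real pi =
       complex_of_real (sqrt a / sqrt (2 * (a + b))) *
       (complex_of_real (K_plus a b + K_minus a b) /
        lauricella_FD (1/2) (1/2) 1
          [-1, complex_of_real (b / a), complex_of_real (- b / a)])) \<and>
     (complex_of_real pi =
       complex_of_real (sqrt 2 * a / sqrt (b * (a + b))) *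
       (complex_of_real (K_plus a b - K_minus a b) /
        lauricella_FD (3/2) (1/2) 2
          [-1, complex_of_real (b / a), complex_of_real (- b / a)]))"
proof (intro conjI)
  define D where "D = K_plus a b - K_minus a b"
  define S where "S = K_plus a b + K_minus a b"
  define q where "q = b / a"
  define w where "w = sqrt (2 * (a + b))"
  have K_pos: "0 < K_minus a b" "0 < D" "0 < S"
    using K_plus_minus_pos[OF assms] by (auto simp: D_def S_def)
  have q: "0 < q" "q < 1" using assms by (auto simp: q_def)
  have w: "w > 0" using assms by (simp add: w_def)
  \<comment> \<open>With these values the Gamma prefactor is 2 / pi when \<gamma> = 2 and 1 / pi
    when \<gamma> = 1.\<close>
  have G: "Gamma (1/2 :: real) = sqrt pi" "Gamma (3/2 :: real) = sqrt pi / 2" "Gamma (2 :: real) = 1"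
    using Gamma_fact[of 1, where 'a = real]
    by (simp_all add: Gamma_one_half_real Gamma_three_halves_real)

  have "((\<lambda>v. v powr (2 * (3/2) - 1) / sqrt ((1 + a\<^sup>2 * v^4) * (1 + b\<^sup>2 * v^4))) has_integral
      K_minus a b / sqrt (a * b * (a + b))) {0<..}"
    using has_integral_octic(2)[OF assms] by (rule has_integral_eq[rotated]) simp
  from lauricella_FD_conjugate_pairs[OF this]
  show "complex_of_real pi =
       complex_of_real (4 / sqrt (a * b * (a + b))) *
       (complex_of_real (K_minus a b) /
        lauricella_FD (3/2) (1/2) 2
          [1 + \<i> * complex_of_real a, 1 - \<i> * complex_of_real a,
           1 + \<i> * complex_of_real b, 1 - \<i> * complex_of_real b])"
    by (rule pi_eq_quotientI) (use assms K_pos in \<open>simp_all add: G\<close>)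

  have "((\<lambda>v. v powr (2 * (1/2) - 1) / sqrt ((1 + a\<^sup>2 * v^4) * (1 + b\<^sup>2 * v^4))) has_integral
      K_minus a b / sqrt (a + b)) {0<..}"
    using has_integral_octic(1)[OF assms] by (rule has_integral_eq[rotated]) simp
  from lauricella_FD_conjugate_pairs[OF this]
  show "complex_of_real pi =
       complex_of_real (4 / sqrt (a + b)) *
       (complex_of_real (K_minus a b) /
        lauricella_FD (1/2) (1/2) 2
          [1 + \<i> * complex_of_real a, 1 - \<i> * complex_of_real a,
           1 + \<i> * complex_of_real b, 1 - \<i> * complex_of_real b])"
    by (rule pi_eq_quotientI) (use assms K_pos in \<open>simp_all add: G\<close>)

  have xs: "x < 1" if "x \<in> set [-1, q, - q]" for x
    using that q by auto
  have args: "map complex_of_real [-1, q, - q] =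
      [-1, complex_of_real (b / a), complex_of_real (- b / a)]"
    by (simp add: q_def)
  have Pfaff_args: "map (\<lambda>x. complex_of_real (x / (x - 1))) [-1, q, - q] =
      [1/2, complex_of_real (b / (b - a)), complex_of_real (b / (a + b))]"
  proof -
    have "q / (q - 1) = b / (b - a)" "- q / (- q - 1) = b / (a + b)"
      using assms by (simp_all add: q_def field_simps)
    moreover have "complex_of_real (1/2) = 1/2" by simp
    ultimately show ?thesis by (simp del: of_real_divide of_real_minus of_real_diff)
  qed
  \<comment> \<open>The Pfaff images of q and -q appear in the opposite order to the claimed
    argument list; the function is symmetric in its arguments.\<close>
  have swap: "lauricella_FD \<alpha> \<beta> \<gamma> [x, y, z] = lauricella_FD \<alpha> \<beta> \<gamma> [x, z, y]" for \<alpha> \<beta> \<gamma> x y z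
    by (simp add: lauricella_FD_def ac_simps)
  \<comment> \<open>This is the product in front of the integral in the Pfaff transformation; the
    argument -1 contributes sqrt 2, which is absorbed in w.\<close>
  have factor: "(\<Prod>x\<leftarrow>[-1, q, - q]. (1 - x) powr (1/2)) = w * sqrt (a - b) / a"
  proof -
    have "(1 - q) * (1 + q) = (a + b) * (a - b) / a\<^sup>2"
      using assms by (simp add: q_def field_simps power2_eq_square)
    then have "sqrt (1 - q) * sqrt (1 + q) = sqrt (a + b) * sqrt (a - b) / a"
      using assms by (simp add: real_sqrt_divide flip: real_sqrt_mult)
    moreover have "w = sqrt 2 * sqrt (a + b)" unfolding w_def by (rule real_sqrt_mult)
    ultimately show ?thesis using q by (simp add: powr_half_sqrt)
  qed

  have "((\<lambda>v. v powr (2 * (1/2) - 1) / sqrt ((1 - v^4) * (1 - q\<^sup>2 * v^4))) has_integral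
      sqrt a * S / (2 * w)) {0<..<1}"
    using K_plus_minus_has_integral(1)[OF assms] unfolding q_def S_def w_def
    by (rule has_integral_eq[rotated]) simp
  from has_integral_powr_quartic[OF _ this] q
  have I: "((\<lambda>u. u powr (1/2 - 1) * (1 - u) powr (1 - 1/2 - 1) /
      (\<Prod>x\<leftarrow>[-1, q, - q]. (1 - x * u) powr (1/2))) has_integral 2 * (sqrt a * S / (2 * w))) {0<..<1}"
    by simp
  have "((\<lambda>v. v powr (2 * (3/2) - 1) / sqrt ((1 - v^4) * (1 - q\<^sup>2 * v^4))) has_integral
      a * D / (2 * sqrt b * w)) {0<..<1}"
    using K_plus_minus_has_integral(2)[OF assms] unfolding q_def D_def w_def
    by (rule has_integral_eq[rotated]) simp
  from has_integral_powr_quartic[OF _ this] q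
  have J: "((\<lambda>u. u powr (3/2 - 1) * (1 - u) powr (2 - 3/2 - 1) /
      (\<Prod>x\<leftarrow>[-1, q, - q]. (1 - x * u) powr (1/2))) has_integral 2 * (a * D / (2 * sqrt b * w))) {0<..<1}"
    by simp

  \<comment> \<open>The Pfaff transformation turns \<alpha> = 3/2, \<gamma> = 2 in \<open>J\<close>
    into first parameter 1/2.\<close>
  have "lauricella_FD (1/2) (1/2) 2 [1/2, complex_of_real (b / (a + b)), complex_of_real (b / (b - a))] =
      complex_of_real (2 * sqrt (a - b) / sqrt b * D / pi)"
    using lauricella_FD_Pfaff[OF xs J] assms w unfolding Pfaff_args factor
    by (subst swap) (simp add: G ac_simps)
  then show "complex_of_real pi =
       complex_of_real (2 * sqrt (a - b) / sqrt b) *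
       (complex_of_real (K_plus a b - K_minus a b) /
        lauricella_FD (1/2) (1/2) 2
          [1/2, complex_of_real (b / (a + b)), complex_of_real (b / (b - a))])"
    unfolding D_def[symmetric]
    by (rule pi_eq_quotientI) (use assms K_pos in simp_all)

  \<comment> \<open>For \<open>I\<close>, with \<alpha> = 1/2 and \<gamma> = 1, the first parameter
    is unchanged.\<close>
  have "lauricella_FD (1/2) (1/2) 1 [1/2, complex_of_real (b / (a + b)), complex_of_real (b / (b - a))] =
      complex_of_real (sqrt a * sqrt (a - b) / a * S / pi)"
    using lauricella_FD_Pfaff[OF xs I] assms w unfolding Pfaff_args factor
    by (subst swap) (simp add: G ac_simps)
  also have "sqrt a * sqrt (a - b) / a = sqrt (a - b) / sqrt a"
    using assms by (simp add: field_simps)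
  finally show "complex_of_real pi =
       complex_of_real (sqrt (a - b) / sqrt a) *
       (complex_of_real (K_plus a b + K_minus a b) /
        lauricella_FD (1/2) (1/2) 1
          [1/2, complex_of_real (b / (a + b)), complex_of_real (b / (b - a))])"
    unfolding S_def[symmetric]
    by (rule pi_eq_quotientI) (use assms K_pos in simp_all)

  have "lauricella_FD (1/2) (1/2) 1 [-1, complex_of_real (b / a), complex_of_real (- b / a)] =
      complex_of_real (sqrt a / w * S / pi)"
    using lauricella_FD_real[OF xs I] unfolding args by (simp add: G)
  then show "complex_of_real pi =
       complex_of_real (sqrt a / sqrt (2 * (a + b))) *
       (complex_of_real (K_plus a b + K_minus a b) /
        lauricella_FD (1/2) (1/2) 1
          [-1, complex_of_real (b / a), complex_of_real (- b / a)])"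
    unfolding S_def[symmetric] w_def[symmetric]
    by (rule pi_eq_quotientI) (use assms K_pos w in simp_all)

  have "lauricella_FD (3/2) (1/2) 2 [-1, complex_of_real (b / a), complex_of_real (- b / a)] =
      complex_of_real (2 * a / (sqrt b * w) * D / pi)"
    using lauricella_FD_real[OF xs J] unfolding args by (simp add: G ac_simps)
  also have "2 * a / (sqrt b * w) = sqrt 2 * a / sqrt (b * (a + b))"
  proof -
    have "sqrt b * w = sqrt 2 * sqrt (b * (a + b))"
      unfolding w_def real_sqrt_mult by simp
    then have "2 * a / (sqrt b * w) = 2 / sqrt 2 * (a / sqrt (b * (a + b)))"
      by (simp only: times_divide_times_eq)
    also have "2 / sqrt 2 = sqrt 2" by (rule real_div_sqrt) simp
    finally show ?thesis by simp
  qed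
  finally show "complex_of_real pi =
       complex_of_real (sqrt 2 * a / sqrt (b * (a + b))) *
       (complex_of_real (K_plus a b - K_minus a b) /
        lauricella_FD (3/2) (1/2) 2
          [-1, complex_of_real (b / a), complex_of_real (- b / a)])"
    unfolding D_def[symmetric]
    by (rule pi_eq_quotientI) (use assms K_pos in simp_all)
qed

end
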